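(* Every digraph $G$ has a majority $4$-colouring; that is, there is a function $f:V(G)\to\{1,2,3,4\}$ such that for every vertex $v\in V(G)$, at most half of the out-neighbours $w$ of $v$ satisfy $f(w)=f(v)$.
   Context: Digraphs are finite, with no loops and no parallel arcs (a pair of oppositely directed arcs $uv$ and $vu$ is allowed). A majority colouring of a digraph is a function that assigns each vertex a colour such that, for each vertex $v$, at most half the out-neighbours of $v$ receive the same colour as $v$ (a vertex with no out-neighbours satisfies this trivially). A majority $c$-colouring is a majority colouring using at most $c$ colours. *)

theory Defs
  imports "Graph_Theory.Digraph" "HOL-Library.FuncSet"
begin

definition out_neighbours :: "('a, 'b) pre_digraph \<Rightarrow> 'a \<Rightarrow> 'a set" where
  "out_neighbours G v = {w. v \<rightarrow>\<^bsub>G\<^esub> w}"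

(* Cardinalities are meaningful only for digraphs with finite out-neighbourhoods; the locale
   digraph (finite, loopless, no parallel arcs, antiparallel arcs allowed) guarantees this. *)
definition majority_colouring :: "('a, 'b) pre_digraph \<Rightarrow> ('a \<Rightarrow> 'c) \<Rightarrow> bool" where
  "majority_colouring G f \<longleftrightarrow>
     (\<forall>v \<in> verts G. real (card {w \<in> out_neighbours G v. f w = f v})
        \<le> real (card (out_neighbours G v)) / 2)"

end

theory Submission
  imports Defs
begin

text \<open>
  Fix a linear order of the vertices. Every arc goes down or up in it, so the digraph is a union of
  two acyclic digraphs. An acyclic digraph has a majority 2-colouring: colour the vertices so that
  each comes after its out-neighbours, and give it the less frequent colour among these. The pair of
  the two colourings is a majority 4-colouring, because an out-neighbour with the same pair of
  colours as \<open>v\<close> is counted in the part that contains the arc to it.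
\<close>

lemma wf_majority_2_colouring:
  fixes N :: "'a \<Rightarrow> 'a set"
  assumes wf: "wf {(w, v). w \<in> N v}" and fin: "\<And>v. finite (N v)"
  obtains g :: "'a \<Rightarrow> bool" where "\<And>v. 2 * card {w \<in> N v. g w = g v} \<le> card (N v)"
proof -
  let ?R = "{(w, v). w \<in> N v}"
  \<comment> \<open>The rule for the less frequent colour, with ties resolved to
    \<open>True\<close>.\<close>
  define F where "F = (\<lambda>g v. 2 * card {w \<in> N v. g w} \<le> card (N v))"
  define g where "g = wfrec ?R F"
  have g: "g v \<longleftrightarrow> 2 * card {w \<in> N v. g w} \<le> card (N v)" for v
  proof -
    have "g v = F (cut g ?R v) v"
      unfolding g_def by (rule wfrec [OF wf])
    \<comment> \<open>\<open>F\<close> consults its first argument only at out-neighbours of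
      \<open>v\<close>, where \<open>cut\<close> leaves \<open>g\<close> unchanged, so the recursion
      equation holds for \<open>g\<close> itself.\<close>
    moreover have "{w \<in> N v. cut g ?R v w} = {w \<in> N v. g w}"
      by (auto simp: cut_def)
    ultimately show ?thesis
      by (simp add: F_def)
  qed
  have "2 * card {w \<in> N v. g w = g v} \<le> card (N v)" for v
  proof (cases "g v")
    case True
    then show ?thesis
      using g [of v] by simp
  next
    case False
    \<comment> \<open>Here \<open>True\<close> is held by more than half of the out-neighbours,
      hence \<open>False\<close> by less than half.\<close>
    have "card (N v) = card ({w \<in> N v. g w} \<union> {w \<in> N v. \<not> g w})"
      by (rule arg_cong [of _ _ card]) auto
    also have "\<dots> = card {w \<in> N v. g w} + card {w \<in> N v. \<not> g w}"
      using fin [of v] by (intro card_Un_disjoint) auto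
    finally show ?thesis
      using False g [of v] by simp
  qed
  then show thesis
    by (rule that)
qed

theorem theorem1:
  fixes G :: "('a, 'b) pre_digraph"
  assumes "digraph G"
  shows "\<exists>f :: 'a \<Rightarrow> nat. f \<in> verts G \<rightarrow> {1, 2, 3, 4} \<and> majority_colouring G f"
proof -
  interpret digraph G by fact
  let ?N = "out_neighbours G"
  have sub: "?N v \<subseteq> verts G" for v
    by (auto simp: out_neighbours_def dest: adj_in_verts)
  have fin: "finite (?N v)" for v
    using sub finite_verts by (rule finite_subset)
  obtain r :: "'a \<Rightarrow> nat" where inj: "inj_on r (verts G)"
    using finite_imp_inj_to_nat_seg [OF finite_verts] by blast
  \<comment> \<open>Upward arcs need a measure that falls as \<open>r\<close> grows:
    \<open>m - r v\<close>. The bound \<open>m\<close> keeps the truncated subtraction strictly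
    decreasing.\<close>
  define m where "m = Max (r ` verts G)"
  have le_m: "r w \<le> m" if "w \<in> verts G" for w
    using that by (simp add: m_def)
  define D where "D v = {w \<in> ?N v. r w < r v}" for v
  define U where "U v = {w \<in> ?N v. r v < r w}" for v
  have finDU: "finite (D v)" "finite (U v)" for v
    using fin by (simp_all add: D_def U_def)
  have "wf {(w, v). w \<in> D v}"
    by (rule wf_subset [OF wf_measure [of r]]) (auto simp: D_def)
  then obtain g :: "'a \<Rightarrow> bool" where g: "\<And>v. 2 * card {w \<in> D v. g w = g v} \<le> card (D v)"
    by (rule wf_majority_2_colouring [OF _ finDU(1)]) (rule that)
  have "m - r w < m - r v" if "w \<in> U v" for v w
    using that sub [of v] le_m [of w] by (auto simp: U_def)
  then have "{(w, v). w \<in> U v} \<subseteq> measure (\<lambda>v. m - r v)"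
    by auto
  then have "wf {(w, v). w \<in> U v}"
    by (rule wf_subset [OF wf_measure])
  then obtain h :: "'a \<Rightarrow> bool" where h: "\<And>v. 2 * card {w \<in> U v. h w = h v} \<le> card (U v)"
    by (rule wf_majority_2_colouring [OF _ finDU(2)]) (rule that)
  \<comment> \<open>An injective code for the pair \<open>(g v, h v)\<close>.\<close>
  define f :: "'a \<Rightarrow> nat" where
    "f v = (if g v then (if h v then 1 else 2) else (if h v then 3 else 4))" for v
  have f_eq: "f w = f v \<longleftrightarrow> g w = g v \<and> h w = h v" for v w
    by (auto simp: f_def)
  have "real (card {w \<in> ?N v. f w = f v}) \<le> real (card (?N v)) / 2" if "v \<in> verts G" for v
  proof -
    \<comment> \<open>Since there are no loops and \<open>r\<close> is injective on the vertices,
      each out-neighbour lies strictly below or above \<open>v\<close>.\<close>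
    have "r w \<noteq> r v" if "w \<in> ?N v" for w
    proof -
      have "w \<noteq> v"
        using that adj_not_same by (auto simp: out_neighbours_def)
      then show ?thesis
        using inj_onD [OF inj, of w v] sub [of v] that \<open>v \<in> verts G\<close> by blast
    qed
    then have N: "?N v = D v \<union> U v"
      by (auto simp: D_def U_def neq_iff)
    \<comment> \<open>Of the two agreements, only the one for the part containing \<open>w\<close>
      is kept.\<close>
    have "card {w \<in> ?N v. f w = f v} \<le> card ({w \<in> D v. g w = g v} \<union> {w \<in> U v. h w = h v})"
      using finDU by (intro card_mono) (auto simp: N f_eq)
    also have "\<dots> \<le> card {w \<in> D v. g w = g v} + card {w \<in> U v. h w = h v}"
      by (rule card_Un_le)
    finally have "2 * card {w \<in> ?N v. f w = f v} \<le> card (D v) + card (U v)"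
      using g [of v] h [of v] by simp
    also have "\<dots> = card (?N v)"
      unfolding N using finDU by (intro card_Un_disjoint [symmetric]) (auto simp: D_def U_def)
    finally show ?thesis
      by linarith
  qed
  then have "majority_colouring G f"
    by (simp add: majority_colouring_def)
  moreover have "f \<in> verts G \<rightarrow> {1, 2, 3, 4}"
    by (auto simp: f_def)
  ultimately show ?thesis
    by blast
qed

end
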